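(* Let $(A_b,A_w)$ be a pairwise comparison system on $C=\{1,\dots,n\}$ with best criterion $b$ and worst criterion $w$, let $D=C\setminus\{b,w\}$, let $D_1,D_2,\epsilon_i,\epsilon_{i,j}$ be as defined in the context, and let $\epsilon^*$ be the optimal objective value of the problem $$\min\ \epsilon\quad\text{s.t.}\quad \left|\frac{w_b}{w_i}-a_{bi}\right|\le\epsilon,\ \left|\frac{w_i}{w_w}-a_{iw}\right|\le\epsilon,\ \left|\frac{w_b}{w_w}-a_{bw}\right|\le\epsilon,\ \sum_{j\in C}w_j=1,\ w_j\ge0\ \text{ for all } i\in D,\ j\in C.$$ For a real number $P$ and $i\in D$ put $$\alpha_i(P)=\frac{a_{bi}-a_{iw}+\sqrt{(a_{bi}+a_{iw})^2-4a_{bi}a_{iw}+4P}}{2},\qquad \beta_i(P)=\frac{-a_{bi}+a_{iw}+\sqrt{(a_{bi}+a_{iw})^2-4a_{bi}a_{iw}+4P}}{2},$$ and let $S(P)$ denote the pair $(\tilde A_b,\tilde A_w)$ with $\tilde a_{bb}=\tilde a_{ww}=1$, $\tilde a_{bw}=P$, $\tilde a_{bi}=\alpha_i(P)$, $\tilde a_{iw}=\beta_i(P)$ for all $i\in D$. Then the following hold. 1. If $\epsilon^*=\epsilon_{i_0}$ for some $i_0\in D_1$, then $S(a_{bw}-\epsilon_{i_0})$ is the only best optimally modified PCS. 2. If $\epsilon^*=\epsilon_{j_0}$ for some $j_0\in D_2$, then $S(a_{bw}+\epsilon_{j_0})$ is the only best optimally modified PCS. 3. If $\epsilon^*=\epsilon_{i_0,j_0}$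 for some $i_0,j_0\in D$, then $S\big((a_{bi_0}+\epsilon_{i_0,j_0})(a_{i_0w}+\epsilon_{i_0,j_0})\big)$ is the only best optimally modified PCS.
   Context: Let $n\ge 3$, $C=\{1,\dots,n\}$ the set of criteria, $b\ne w$ in $C$ the best and worst criterion, $D=C\setminus\{b,w\}$. A pairwise comparison system (PCS) is a pair $(A_b,A_w)$ with $A_b=(a_{b1},\dots,a_{bn})$ and $A_w=(a_{1w},\dots,a_{nw})^T$ of real numbers, where $a_{ij}$ is the relative preference of criterion $i$ over criterion $j$, with $a_{bb}=a_{ww}=1$ and $1\le a_{bi},a_{iw}\le a_{bw}$ for all $i\in D$ (so $a_{bw}\ge1$). The variable $w_j$ is the weight of criterion $j$; in the weight problem, denominators are required to be nonzero. $D_1=\{i\in D:a_{bi}a_{iw}<a_{bw}\}$, $D_2=\{i\in D:a_{bi}a_{iw}>a_{bw}\}$, and for $i,j\in D$ $$\epsilon_i=\left|\frac{a_{bi}+a_{iw}+1-\sqrt{(a_{bi}+a_{iw}+1)^2-4(a_{bi}a_{iw}-a_{bw})}}{2}\right|,\qquad \epsilon_{i,j}=\left|\frac{a_{bi}a_{iw}-a_{bj}a_{jw}}{a_{bi}+a_{iw}+a_{bj}+a_{jw}}\right|.$$ Optimally modified PCS: consider the problem $$\min\ \eta\quad\text{s.t.}\quad |\tilde a_{bi}-a_{bi}|\le\eta,\ |\tilde a_{iw}-a_{iw}|\le\eta,\ |\tilde a_{bw}-a_{bw}|\le\eta,\ \tilde a_{bi}\tilde a_{iw}=\tilde a_{bw},\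 \tilde a_{bi},\tilde a_{iw},\tilde a_{bw}\ge 0\ \text{ for all } i\in D .$$ Its optimal value is denoted $\eta^*$ (it is known that $\eta^*=\epsilon^*$). The entries of an optimal solution, completed by $\tilde a_{bb}=\tilde a_{ww}=1$, form an optimally modified PCS $(\tilde A_b,\tilde A_w)$. A best optimally modified PCS is an optimally modified PCS $(\tilde A_b,\tilde A_w)$ which, for every $i\in C$ simultaneously, has the minimum value of $\max\{|\tilde a_{bi}-a_{bi}|,|\tilde a_{iw}-a_{iw}|\}$ among all optimally modified PCS.
   Formalization: Part 3 is proved for i_0, j_0 labelled so that a_{bi_0}a_{i_0w} ≤ a_{bj_0}a_{j_0w}; ε_{i,j} is symmetric but the formula for P is not, and with the opposite strict order the claim is false. *)

theory Defs
  imports "HOL-Analysis.Analysis"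
begin

text \<open>
  The criteria are the elements of a finite index type \<open>'n\<close> with \<open>n = CARD('n)\<close>.  The vector
  \<open>Ab\<close> holds the comparisons \<open>Ab $ i\<close> of the best criterion over \<open>i\<close>, the vector \<open>Aw\<close> the
  comparisons \<open>Aw $ i\<close> of \<open>i\<close> over the worst criterion.  The comparison of best over worst
  occurs in both vectors, as \<open>Ab $ w\<close> and as \<open>Aw $ b\<close>.
\<close>

definition others :: "'n \<Rightarrow> 'n \<Rightarrow> 'n set" where
  "others b w = UNIV - {b, w}"

definition pcs_shape :: "'n \<Rightarrow> 'n \<Rightarrow> real ^ 'n \<Rightarrow> real ^ 'n \<Rightarrow> bool" where
  "pcs_shape b w Ab Aw \<longleftrightarrow> Ab $ b = 1 \<and> Aw $ w = 1 \<and> Aw $ b = Ab $ w"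

definition pcs :: "'n \<Rightarrow> 'n \<Rightarrow> real ^ 'n \<Rightarrow> real ^ 'n \<Rightarrow> bool" where
  "pcs b w Ab Aw \<longleftrightarrow> pcs_shape b w Ab Aw \<and>
     (\<forall>i\<in>others b w. 1 \<le> Ab $ i \<and> Ab $ i \<le> Ab $ w \<and> 1 \<le> Aw $ i \<and> Aw $ i \<le> Ab $ w)"

definition D1 :: "'n \<Rightarrow> 'n \<Rightarrow> real ^ 'n \<Rightarrow> real ^ 'n \<Rightarrow> 'n set" where
  "D1 b w Ab Aw = {i \<in> others b w. Ab $ i * Aw $ i < Ab $ w}"

definition D2 :: "'n \<Rightarrow> 'n \<Rightarrow> real ^ 'n \<Rightarrow> real ^ 'n \<Rightarrow> 'n set" where
  "D2 b w Ab Aw = {i \<in> others b w. Ab $ i * Aw $ i > Ab $ w}"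

definition eps_single :: "'n \<Rightarrow> real ^ 'n \<Rightarrow> real ^ 'n \<Rightarrow> 'n \<Rightarrow> real" where
  "eps_single w Ab Aw i =
     \<bar>(Ab $ i + Aw $ i + 1 - sqrt ((Ab $ i + Aw $ i + 1)\<^sup>2 - 4 * (Ab $ i * Aw $ i - Ab $ w))) / 2\<bar>"

definition eps_pair :: "real ^ 'n \<Rightarrow> real ^ 'n \<Rightarrow> 'n \<Rightarrow> 'n \<Rightarrow> real" where
  "eps_pair Ab Aw i j =
     \<bar>(Ab $ i * Aw $ i - Ab $ j * Aw $ j) / (Ab $ i + Aw $ i + Ab $ j + Aw $ j)\<bar>"

text \<open>
  The weight problem.  Division by zero is total in HOL, so the requirement that all
  denominators be nonzero is explicit.
\<close>

definition weight_feasible ::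
    "'n::finite \<Rightarrow> 'n \<Rightarrow> real ^ 'n \<Rightarrow> real ^ 'n \<Rightarrow> real ^ 'n \<Rightarrow> real \<Rightarrow> bool" where
  "weight_feasible b w Ab Aw x e \<longleftrightarrow>
     (\<forall>i\<in>others b w. x $ i \<noteq> 0) \<and> x $ w \<noteq> 0 \<and>
     (\<forall>i\<in>others b w. \<bar>x $ b / x $ i - Ab $ i\<bar> \<le> e \<and> \<bar>x $ i / x $ w - Aw $ i\<bar> \<le> e) \<and>
     \<bar>x $ b / x $ w - Ab $ w\<bar> \<le> e \<and>
     (\<Sum>j\<in>UNIV. x $ j) = 1 \<and> (\<forall>j. 0 \<le> x $ j)"

definition eps_star :: "'n::finite \<Rightarrow> 'n \<Rightarrow> real ^ 'n \<Rightarrow> real ^ 'n \<Rightarrow> real" where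
  "eps_star b w Ab Aw = Inf {e. \<exists>x. weight_feasible b w Ab Aw x e}"

definition mod_feasible ::
    "'n \<Rightarrow> 'n \<Rightarrow> real ^ 'n \<Rightarrow> real ^ 'n \<Rightarrow> real ^ 'n \<Rightarrow> real ^ 'n \<Rightarrow> real \<Rightarrow> bool" where
  "mod_feasible b w Ab Aw Xb Xw \<eta> \<longleftrightarrow>
     (\<forall>i\<in>others b w. \<bar>Xb $ i - Ab $ i\<bar> \<le> \<eta> \<and> \<bar>Xw $ i - Aw $ i\<bar> \<le> \<eta> \<and>
        Xb $ i * Xw $ i = Xb $ w \<and> 0 \<le> Xb $ i \<and> 0 \<le> Xw $ i) \<and>
     \<bar>Xb $ w - Ab $ w\<bar> \<le> \<eta> \<and> 0 \<le> Xb $ w"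

definition optimally_modified ::
    "'n \<Rightarrow> 'n \<Rightarrow> real ^ 'n \<Rightarrow> real ^ 'n \<Rightarrow> real ^ 'n \<Rightarrow> real ^ 'n \<Rightarrow> bool" where
  "optimally_modified b w Ab Aw Xb Xw \<longleftrightarrow>
     pcs_shape b w Xb Xw \<and>
     (\<exists>\<eta>. mod_feasible b w Ab Aw Xb Xw \<eta> \<and>
        (\<forall>Yb Yw \<theta>. mod_feasible b w Ab Aw Yb Yw \<theta> \<longrightarrow> \<eta> \<le> \<theta>))"

definition best_optimally_modified ::
    "'n \<Rightarrow> 'n \<Rightarrow> real ^ 'n \<Rightarrow> real ^ 'n \<Rightarrow> real ^ 'n \<Rightarrow> real ^ 'n \<Rightarrow> bool" where
  "best_optimally_modified b w Ab Aw Xb Xw \<longleftrightarrow>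
     optimally_modified b w Ab Aw Xb Xw \<and>
     (\<forall>i Yb Yw. optimally_modified b w Ab Aw Yb Yw \<longrightarrow>
        max \<bar>Xb $ i - Ab $ i\<bar> \<bar>Xw $ i - Aw $ i\<bar> \<le> max \<bar>Yb $ i - Ab $ i\<bar> \<bar>Yw $ i - Aw $ i\<bar>)"

definition alpha :: "real ^ 'n \<Rightarrow> real ^ 'n \<Rightarrow> real \<Rightarrow> 'n \<Rightarrow> real" where
  "alpha Ab Aw P i =
     (Ab $ i - Aw $ i + sqrt ((Ab $ i + Aw $ i)\<^sup>2 - 4 * Ab $ i * Aw $ i + 4 * P)) / 2"

definition beta :: "real ^ 'n \<Rightarrow> real ^ 'n \<Rightarrow> real \<Rightarrow> 'n \<Rightarrow> real" where
  "beta Ab Aw P i =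
     (- Ab $ i + Aw $ i + sqrt ((Ab $ i + Aw $ i)\<^sup>2 - 4 * Ab $ i * Aw $ i + 4 * P)) / 2"

definition S_pcs ::
    "'n::finite \<Rightarrow> 'n \<Rightarrow> real ^ 'n \<Rightarrow> real ^ 'n \<Rightarrow> real \<Rightarrow> (real ^ 'n) \<times> (real ^ 'n)" where
  "S_pcs b w Ab Aw P =
     ((\<chi> i. if i = b then 1 else if i = w then P else alpha Ab Aw P i),
      (\<chi> i. if i = w then 1 else if i = b then P else beta Ab Aw P i))"

end

theory Submission imports Defs begin

text \<open>
  Fix the best-over-worst entry \<open>P \<ge> 0\<close> of a modified system.  The remaining constraints then
  decouple: each criterion \<open>i\<close> has to move its point \<open>(a, c)\<close> of comparisons to the hyperbola
  \<open>x * y = P\<close>.  In the maximum norm the cheapest way is to move both coordinates by the same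
  signed amount \<open>t\<close>, the larger root of \<open>(a + t) * (c + t) = P\<close>; here it is called
  \<open>shift a c P\<close>.  When \<open>P > 0\<close> this nearest point is the only one, and it is
  \<open>(\<alpha>\<^sub>i(P), \<beta>\<^sub>i(P))\<close>.  Hence \<open>S(P)\<close> is, simultaneously for all criteria, the unique closest
  modified system with entry \<open>P\<close>.

  It follows that the modification problem is a problem in the single variable \<open>P\<close>: minimise the
  largest of \<open>\<bar>P - a\<^sub>b\<^sub>w\<bar>\<close> and the numbers \<open>\<bar>shift a c P\<bar>\<close> (predicate \<open>admissible\<close>).  By
  compactness its minimum is attained.  The minimum is less than \<open>a\<^sub>b\<^sub>w\<close>, because \<open>P = a\<^sub>b\<^sub>w\<close>
  already does better than that, so an optimal \<open>P\<close> is positive; positive solutions are exactly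
  the ratios of weights, and therefore the minimum equals \<open>\<epsilon>\<^sup>*\<close> (lemma \<open>eps_star_least\<close>).

  If only one \<open>P\<close> is admissible at level \<open>\<epsilon>\<^sup>*\<close>, then \<open>S(P)\<close> is the only best optimally modified
  system (lemma \<open>best_singleton\<close>).  In each of the three cases this uniqueness comes from two
  bounds on \<open>P\<close> that meet when \<open>\<epsilon>\<close> is \<open>\<epsilon>\<^sup>*\<close>: among
  \<open>a\<^sub>b\<^sub>w - \<epsilon> \<le> P \<le> a\<^sub>b\<^sub>w + \<epsilon>\<close> and \<open>(a - \<epsilon>) * (c - \<epsilon>) \<le> P \<le> (a + \<epsilon>) * (c + \<epsilon>)\<close> (the lower
  product bound for \<open>\<epsilon> \<le> min a c\<close>), the numbers \<open>\<epsilon>\<^sub>i\<close> and \<open>\<epsilon>\<^sub>i\<^sub>,\<^sub>j\<close> are the values of \<open>\<epsilon>\<close> at which a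
  lower bound equals an upper bound: \<open>a\<^sub>b\<^sub>w - \<epsilon>\<close> meets the upper product bound of \<open>i \<in> D\<^sub>1\<close>,
  \<open>a\<^sub>b\<^sub>w + \<epsilon>\<close> meets the lower product bound of \<open>i \<in> D\<^sub>2\<close>, and the product bounds of two criteria
  meet each other at \<open>\<epsilon>\<^sub>i\<^sub>,\<^sub>j\<close>.
\<close>

section \<open>The nearest point of a hyperbola in the maximum norm\<close>

definition shift :: "real \<Rightarrow> real \<Rightarrow> real \<Rightarrow> real" where
  "shift a c P = (sqrt ((a - c)\<^sup>2 + 4 * P) - (a + c)) / 2"

text \<open>
  The square root is that of the discriminant \<open>(a + c)\<^sup>2 - 4 * (a * c - P)\<close> of
  \<open>(a + t) * (c + t) = P\<close>.
\<close>

lemma shift_root: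
  assumes "0 \<le> P"
  shows "(a + shift a c P) * (c + shift a c P) = P"
    and "0 \<le> a + shift a c P" and "0 \<le> c + shift a c P"
proof -
  let ?r = "sqrt ((a - c)\<^sup>2 + 4 * P)"
  have r2: "?r\<^sup>2 = (a - c)\<^sup>2 + 4 * P"
    using assms by simp
  have r: "\<bar>a - c\<bar> \<le> ?r"
    by (rule real_le_rsqrt) (use assms in simp)
  have a: "a + shift a c P = (?r + (a - c)) / 2" and c: "c + shift a c P = (?r - (a - c)) / 2"
    unfolding shift_def by (simp_all add: field_simps)
  have "(a + shift a c P) * (c + shift a c P) = (?r\<^sup>2 - (a - c)\<^sup>2) / 4"
    unfolding a c by (simp add: algebra_simps power2_eq_square)
  then show "(a + shift a c P) * (c + shift a c P) = P"
    using r2 by simp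
  show "0 \<le> a + shift a c P" "0 \<le> c + shift a c P"
    unfolding a c using r by simp_all
qed

lemma alpha_eq_shift: "alpha Ab Aw P i = Ab $ i + shift (Ab $ i) (Aw $ i) P"
  and beta_eq_shift: "beta Ab Aw P i = Aw $ i + shift (Ab $ i) (Aw $ i) P"
proof -
  have "(Ab $ i + Aw $ i)\<^sup>2 - 4 * Ab $ i * Aw $ i + 4 * P = (Ab $ i - Aw $ i)\<^sup>2 + 4 * P"
    by (simp add: power2_eq_square algebra_simps)
  then show "alpha Ab Aw P i = Ab $ i + shift (Ab $ i) (Aw $ i) P"
    and "beta Ab Aw P i = Aw $ i + shift (Ab $ i) (Aw $ i) P"
    unfolding alpha_def beta_def shift_def by (simp_all add: field_simps)
qed

text \<open>
  Products of nonnegative numbers are monotone: if both coordinates of a point moved by less than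
  \<open>\<bar>t\<bar>\<close>, their product would fall short of \<open>(a + t) * (c + t)\<close> for \<open>t > 0\<close> and exceed it for
  \<open>t < 0\<close>.
\<close>

lemma shift_le_deviation:
  assumes "0 \<le> x" "0 \<le> y" "0 \<le> a" "0 \<le> c"
  shows "\<bar>shift a c (x * y)\<bar> \<le> max \<bar>x - a\<bar> \<bar>y - c\<bar>"
proof (rule ccontr)
  define t where "t = shift a c (x * y)"
  have root: "(a + t) * (c + t) = x * y" and nonneg: "0 \<le> a + t" "0 \<le> c + t"
    unfolding t_def using shift_root[where P = "x * y" and a = a and c = c] assms by simp_all
  assume "\<not> ?thesis"
  then have small: "\<bar>x - a\<bar> < \<bar>t\<bar>" "\<bar>y - c\<bar> < \<bar>t\<bar>"
    unfolding t_def by simp_all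
  show False
  proof (cases "0 \<le> t")
    case True
    with small have "x < a + t" "y < c + t" by linarith+
    then have "x * y < (a + t) * (c + t)"
      using assms by (intro mult_strict_mono') auto
    with root show False by simp
  next
    case False
    with small have "a + t < x" "c + t < y" by linarith+
    then have "(a + t) * (c + t) < x * y"
      using nonneg by (intro mult_strict_mono') auto
    with root show False by simp
  qed
qed

text \<open>
  Positivity of the product is essential: on \<open>x * y = 0\<close> one coordinate can vanish while the other
  one is free.
\<close>

lemma nearest_point_unique:
  assumes "0 \<le> x" "0 \<le> y" and pos: "0 < x * y"
    and near: "max \<bar>x - a\<bar> \<bar>y - c\<bar> \<le> \<bar>shift a c (x * y)\<bar>"
  shows "x = a + shift a c (x * y)" and "y = c + shift a c (x * y)"
proof -
  define t where "t = shift a c (x * y)"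
  have root: "(a + t) * (c + t) = x * y" and nonneg: "0 \<le> a + t" "0 \<le> c + t"
    unfolding t_def using shift_root[where P = "x * y" and a = a and c = c] assms by simp_all
  have gt: "0 < a + t" "0 < c + t" "0 < x" "0 < y"
    using root pos nonneg assms(1,2) by (auto simp: zero_less_mult_iff order_less_le)
  have d: "\<bar>x - a\<bar> \<le> \<bar>t\<bar>" "\<bar>y - c\<bar> \<le> \<bar>t\<bar>"
    using near unfolding t_def by simp_all
  have "x = a + t \<and> y = c + t"
  proof (cases "0 \<le> t")
    case True
    with d have le: "x \<le> a + t" "y \<le> c + t" by linarith+
    have "x * y \<le> x * (c + t)" "x * (c + t) \<le> (a + t) * (c + t)"
      using le gt by (simp_all add: mult_right_mono)
    then have "x * y = x * (c + t)" "x * (c + t) = (a + t) * (c + t)"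
      using root by linarith+
    then show ?thesis using gt by simp
  next
    case False
    with d have le: "a + t \<le> x" "c + t \<le> y" by linarith+
    have "x * (c + t) \<le> x * y" "(a + t) * (c + t) \<le> x * (c + t)"
      using le gt by (simp_all add: mult_right_mono)
    then have "x * y = x * (c + t)" "x * (c + t) = (a + t) * (c + t)"
      using root by linarith+
    then show ?thesis using gt by simp
  qed
  then show "x = a + shift a c (x * y)" "y = c + shift a c (x * y)"
    unfolding t_def by simp_all
qed

lemma product_le_if_shift_le:
  assumes "0 \<le> P" "\<bar>shift a c P\<bar> \<le> e" "0 \<le> a" "0 \<le> c"
  shows "P \<le> (a + e) * (c + e)"
proof -
  have "(a + shift a c P) * (c + shift a c P) \<le> (a + e) * (c + e)"
    using shift_root(2,3)[OF assms(1), where a = a and c = c] assms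
    by (intro mult_mono) auto
  then show ?thesis using shift_root(1)[OF assms(1), of a c] by simp
qed

lemma product_ge_if_shift_le:
  assumes "0 \<le> P" "\<bar>shift a c P\<bar> \<le> e" "e \<le> a" "e \<le> c"
  shows "(a - e) * (c - e) \<le> P"
proof -
  have "(a - e) * (c - e) \<le> (a + shift a c P) * (c + shift a c P)"
    using shift_root(2,3)[OF assms(1), where a = a and c = c] assms by (intro mult_mono) auto
  then show ?thesis using shift_root(1)[OF assms(1), of a c] by simp
qed

section \<open>Reduction to the best-over-worst entry\<close>

definition admissible :: "'n \<Rightarrow> 'n \<Rightarrow> real ^ 'n \<Rightarrow> real ^ 'n \<Rightarrow> real \<Rightarrow> real \<Rightarrow> bool" where
  "admissible b w Ab Aw P e \<longleftrightarrow> 0 \<le> P \<and> \<bar>P - Ab $ w\<bar> \<le> e \<and>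
     (\<forall>i\<in>others b w. \<bar>shift (Ab $ i) (Aw $ i) P\<bar> \<le> e)"

lemma pcs_bounds:
  assumes "pcs b w Ab Aw" "i \<in> others b w"
  shows "1 \<le> Ab $ i" "Ab $ i \<le> Ab $ w" "1 \<le> Aw $ i" "Aw $ i \<le> Ab $ w"
  using assms unfolding pcs_def by blast+

lemma mod_feasible_admissible:
  assumes pcs: "pcs b w Ab Aw" and feas: "mod_feasible b w Ab Aw Xb Xw e"
  shows "admissible b w Ab Aw (Xb $ w) e"
proof -
  have "\<bar>shift (Ab $ i) (Aw $ i) (Xb $ w)\<bar> \<le> e" if i: "i \<in> others b w" for i
  proof -
    have "Xb $ i * Xw $ i = Xb $ w" "0 \<le> Xb $ i" "0 \<le> Xw $ i"
      "max \<bar>Xb $ i - Ab $ i\<bar> \<bar>Xw $ i - Aw $ i\<bar> \<le> e"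
      using feas i unfolding mod_feasible_def by auto
    then show ?thesis
      using shift_le_deviation[of "Xb $ i" "Xw $ i" "Ab $ i" "Aw $ i"] pcs_bounds[OF pcs i]
      by (auto intro: order_trans)
  qed
  then show ?thesis
    using feas unfolding admissible_def mod_feasible_def by blast
qed

lemma S_pcs_mod_feasible:
  assumes "b \<noteq> w" and adm: "admissible b w Ab Aw P e"
  shows "mod_feasible b w Ab Aw (fst (S_pcs b w Ab Aw P)) (snd (S_pcs b w Ab Aw P)) e"
  using assms shift_root[of P]
  unfolding mod_feasible_def admissible_def S_pcs_def others_def
  by (auto simp: alpha_eq_shift beta_eq_shift)

lemma S_pcs_shape:
  assumes "b \<noteq> w"
  shows "pcs_shape b w (fst (S_pcs b w Ab Aw P)) (snd (S_pcs b w Ab Aw P))"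
  using assms unfolding pcs_shape_def S_pcs_def by simp

section \<open>The common optimal value of both problems\<close>

lemma weight_feasible_admissible:
  assumes pcs: "pcs b w Ab Aw" and feas: "weight_feasible b w Ab Aw x e"
  shows "\<exists>P. admissible b w Ab Aw P e"
proof -
  define P where "P = x $ b / x $ w"
  have "0 \<le> P"
    using feas unfolding weight_feasible_def P_def by simp
  moreover have "\<bar>P - Ab $ w\<bar> \<le> e"
    using feas unfolding weight_feasible_def P_def by simp
  moreover have "\<bar>shift (Ab $ i) (Aw $ i) P\<bar> \<le> e" if i: "i \<in> others b w" for i
  proof -
    let ?u = "x $ b / x $ i" and ?v = "x $ i / x $ w"
    have "?u * ?v = P" "0 \<le> ?u" "0 \<le> ?v" "max \<bar>?u - Ab $ i\<bar> \<bar>?v - Aw $ i\<bar> \<le> e"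
      using feas i unfolding weight_feasible_def P_def by auto
    then show ?thesis
      using shift_le_deviation[of ?u ?v "Ab $ i" "Aw $ i"] pcs_bounds[OF pcs i]
      by (auto intro: order_trans)
  qed
  ultimately show ?thesis unfolding admissible_def by blast
qed

text \<open>
  The weights are the worst-column entries \<open>(P, \<beta>\<^sub>i(P), 1)\<close> of \<open>S(P)\<close>, scaled to sum 1.  For
  \<open>P = 0\<close> a weight in a denominator can vanish.
\<close>

lemma admissible_weight_feasible:
  fixes b w :: "'n::finite"
  assumes bw: "b \<noteq> w" and pos: "0 < P" and adm: "admissible b w Ab Aw P e"
  shows "\<exists>x. weight_feasible b w Ab Aw x e"
proof -
  define y where "y j = (if j = b then P else if j = w then 1 else beta Ab Aw P j)" for j
  define T where "T = (\<Sum>j\<in>UNIV. y j)"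
  define x :: "real ^ 'n" where "x = (\<chi> j. y j / T)"
  have ab: "alpha Ab Aw P i * beta Ab Aw P i = P" "0 \<le> alpha Ab Aw P i" "0 \<le> beta Ab Aw P i" for i
    using shift_root[where P = P and a = "Ab $ i" and c = "Aw $ i"] pos by (simp_all add: alpha_eq_shift beta_eq_shift)
  have beta_pos: "0 < beta Ab Aw P i" for i
    using ab[of i] pos by (auto simp: order_less_le)
  have y_pos: "0 < y j" for j
    unfolding y_def using pos beta_pos by simp
  have T: "0 < T"
    unfolding T_def using y_pos by (intro sum_pos) auto
  have ratio: "x $ i / x $ j = y i / y j" for i j
    unfolding x_def using T by simp
  have x_pos: "0 < x $ j" for j
    unfolding x_def using T y_pos by simp
  have sum1: "(\<Sum>j\<in>UNIV. x $ j) = 1"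
    unfolding x_def using T by (simp add: T_def flip: sum_divide_distrib)
  have bi: "x $ b / x $ i = alpha Ab Aw P i" and iw: "x $ i / x $ w = beta Ab Aw P i"
    if "i \<in> others b w" for i
    using that bw ab(1)[of i] beta_pos[of i]
    unfolding ratio y_def others_def by (auto simp: field_simps)
  have bw_ratio: "x $ b / x $ w = P"
    unfolding ratio y_def using bw by simp
  have "weight_feasible b w Ab Aw x e"
    unfolding weight_feasible_def
    using adm x_pos sum1 bi iw bw_ratio
    by (auto simp: admissible_def alpha_eq_shift beta_eq_shift less_imp_le less_imp_neq[THEN not_sym])
  then show ?thesis ..
qed

text \<open>
  This strict bound is what excludes \<open>P = 0\<close> at the optimum.
  At \<open>P = a\<^sub>b\<^sub>w\<close> every shift is smaller than \<open>a\<^sub>b\<^sub>w\<close>: upwards, because a shift by \<open>a\<^sub>b\<^sub>w\<close> would already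
  give a product larger than \<open>a\<^sub>b\<^sub>w\<close>; downwards, because the shifted comparisons stay positive.
\<close>

lemma admissible_below_bw:
  fixes b w :: "'n::finite"
  assumes pcs: "pcs b w Ab Aw" and A: "1 \<le> Ab $ w"
  shows "\<exists>e < Ab $ w. admissible b w Ab Aw (Ab $ w) e"
proof -
  define A where "A = Ab $ w"
  define s where "s i = \<bar>shift (Ab $ i) (Aw $ i) A\<bar>" for i
  define e where "e = Max (insert 0 (s ` others b w))"
  have "s i < A" if i: "i \<in> others b w" for i
  proof -
    define t where "t = shift (Ab $ i) (Aw $ i) A"
    note bounds = pcs_bounds[OF pcs i, folded A_def]
    have root: "(Ab $ i + t) * (Aw $ i + t) = A" "0 \<le> Ab $ i + t" "0 \<le> Aw $ i + t"
      unfolding t_def using shift_root[where P = A and a = "Ab $ i" and c = "Aw $ i"] A A_def by simp_all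
    have "0 < Ab $ i + t"
      using root A A_def by (auto simp: order_less_le)
    with bounds have "- A < t" by linarith
    moreover have "t < A"
    proof (rule ccontr)
      assume "\<not> t < A"
      then have "(1 + A) * (1 + A) \<le> (Ab $ i + t) * (Aw $ i + t)"
        using bounds A A_def by (intro mult_mono) auto
      moreover have "A < (1 + A) * (1 + A)"
        using A A_def by (simp add: algebra_simps add_pos_pos)
      ultimately show False using root by simp
    qed
    ultimately show ?thesis unfolding s_def t_def by linarith
  qed
  then have "e < A"
    unfolding e_def using A A_def by (subst Max_less_iff) auto
  moreover have "s i \<le> e" if "i \<in> others b w" for i
    unfolding e_def using that by (intro Max_ge) auto
  moreover have "0 \<le> e"
    unfolding e_def by (intro Max_ge) auto
  ultimately show ?thesis
    using A unfolding admissible_def s_def A_def by auto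
qed

lemma exists_least_admissible:
  fixes b w :: "'n::finite"
  assumes pcs: "pcs b w Ab Aw" and A: "1 \<le> Ab $ w"
  obtains P e where "admissible b w Ab Aw P e"
    and "\<And>P' e'. admissible b w Ab Aw P' e' \<Longrightarrow> e \<le> e'" and "e < Ab $ w"
proof -
  let ?adm = "admissible b w Ab Aw"
  obtain e0 where e0: "e0 < Ab $ w" "?adm (Ab $ w) e0"
    using admissible_below_bw[OF assms] by blast
  \<comment> \<open>Any better pair lies in a bounded part of the closed set of all admissible pairs.\<close>
  define K where "K = {(e, P). ?adm P e} \<inter> {0..e0} \<times> {0..2 * Ab $ w}"
  have "{(e, P). ?adm P e} = {z. 0 \<le> snd z} \<inter> {z. \<bar>snd z - Ab $ w\<bar> \<le> fst z} \<inter>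
      (\<Inter>i\<in>others b w. {z. \<bar>shift (Ab $ i) (Aw $ i) (snd z)\<bar> \<le> fst z})"
    unfolding admissible_def by auto
  also have "closed \<dots>"
    unfolding shift_def
    by (intro closed_Int closed_INT ballI closed_Collect_le continuous_intros) auto
  finally have "compact K"
    unfolding K_def by (intro closed_Int_compact compact_Times compact_Icc)
  moreover have "(e0, Ab $ w) \<in> K"
    unfolding K_def using e0 A by (auto simp: admissible_def)
  moreover have "continuous_on K fst"
    by (intro continuous_intros)
  ultimately obtain z where z: "z \<in> K" "\<And>z'. z' \<in> K \<Longrightarrow> fst z \<le> fst z'"
    using continuous_attains_inf[of K fst] by blast
  have "fst z \<le> e'" if "?adm P' e'" for P' e'
  proof (cases "e' \<le> e0")
    case True
    with that e0 have "(e', P') \<in> K"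
      unfolding K_def admissible_def by auto
    then show ?thesis using z(2) by fastforce
  next
    case False
    then show ?thesis using z(1) unfolding K_def by auto
  qed
  moreover have "?adm (snd z) (fst z)" "fst z < Ab $ w"
    using z(1) e0 unfolding K_def by auto
  ultimately show thesis using that by blast
qed

lemma eps_star_least:
  fixes b w :: "'n::finite"
  assumes bw: "b \<noteq> w" and pcs: "pcs b w Ab Aw" and A: "1 \<le> Ab $ w"
  shows "\<exists>P. admissible b w Ab Aw P (eps_star b w Ab Aw)"
    and "admissible b w Ab Aw P' e' \<Longrightarrow> eps_star b w Ab Aw \<le> e'"
proof -
  obtain P e where P: "admissible b w Ab Aw P e"
    and least: "\<And>P' e'. admissible b w Ab Aw P' e' \<Longrightarrow> e \<le> e'" and lt: "e < Ab $ w"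
    using exists_least_admissible[OF pcs A] by blast
  have "0 < P"
    using P lt unfolding admissible_def by linarith
  then have "\<exists>x. weight_feasible b w Ab Aw x e"
    using admissible_weight_feasible[OF bw _ P] by blast
  moreover have "e \<le> e'" if "\<exists>x. weight_feasible b w Ab Aw x e'" for e'
    using that weight_feasible_admissible[OF pcs] least by blast
  ultimately have "eps_star b w Ab Aw = e"
    unfolding eps_star_def by (intro cInf_eq_minimum) auto
  then show "\<exists>P. admissible b w Ab Aw P (eps_star b w Ab Aw)"
    and "admissible b w Ab Aw P' e' \<Longrightarrow> eps_star b w Ab Aw \<le> e'"
    using P least by auto
qed

lemma optimally_modified_iff:
  fixes b w :: "'n::finite"
  assumes bw: "b \<noteq> w" and pcs: "pcs b w Ab Aw" and A: "1 \<le> Ab $ w"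
  shows "optimally_modified b w Ab Aw Xb Xw \<longleftrightarrow>
    pcs_shape b w Xb Xw \<and> mod_feasible b w Ab Aw Xb Xw (eps_star b w Ab Aw)"
proof -
  let ?e = "eps_star b w Ab Aw"
  have least: "?e \<le> \<theta>" if "mod_feasible b w Ab Aw Yb Yw \<theta>" for Yb Yw \<theta>
    using that mod_feasible_admissible[OF pcs] eps_star_least(2)[OF assms] by blast
  obtain Yb Yw where "mod_feasible b w Ab Aw Yb Yw ?e"
    using eps_star_least(1)[OF assms] S_pcs_mod_feasible[OF bw] by blast
  then have "\<eta> = ?e" if "mod_feasible b w Ab Aw Xb Xw \<eta>"
      "\<forall>Yb Yw \<theta>. mod_feasible b w Ab Aw Yb Yw \<theta> \<longrightarrow> \<eta> \<le> \<theta>" for \<eta>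
    using that least by (meson order_antisym)
  then show ?thesis
    unfolding optimally_modified_def using least by blast
qed

section \<open>Uniqueness of the best optimally modified system\<close>

text \<open>
  With \<open>P\<close> forced, the deviations of the criteria \<open>b\<close> and \<open>w\<close> are the same for all optimal systems,
  and the nearest points \<open>(\<alpha>\<^sub>i(P), \<beta>\<^sub>i(P))\<close> can be chosen independently of each other.  So \<open>S(P)\<close>
  attains the minimum for every criterion, and by \<open>nearest_point_unique\<close> nothing else does.
\<close>

lemma best_singleton:
  fixes b w :: "'n::finite"
  assumes bw: "b \<noteq> w" and pcs: "pcs b w Ab Aw" and A: "1 \<le> Ab $ w" and pos: "0 < P"
    and unique: "\<And>Q. admissible b w Ab Aw Q (eps_star b w Ab Aw) \<Longrightarrow> Q = P"
  shows "{(Xb, Xw). best_optimally_modified b w Ab Aw Xb Xw} = {S_pcs b w Ab Aw P}"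
proof -
  let ?opt = "optimally_modified b w Ab Aw"
  define Sb where "Sb = fst (S_pcs b w Ab Aw P)"
  define Sw where "Sw = snd (S_pcs b w Ab Aw P)"
  have S: "S_pcs b w Ab Aw P = (Sb, Sw)"
    unfolding Sb_def Sw_def by simp
  have entries: "Sb $ b = 1" "Sb $ w = P" "Sw $ w = 1" "Sw $ b = P"
    using bw unfolding Sb_def Sw_def S_pcs_def by simp_all
  have S_others: "Sb $ i = Ab $ i + shift (Ab $ i) (Aw $ i) P"
    "Sw $ i = Aw $ i + shift (Ab $ i) (Aw $ i) P" if "i \<in> others b w" for i
    using that unfolding Sb_def Sw_def S_pcs_def others_def
    by (simp_all add: alpha_eq_shift beta_eq_shift)
  have "admissible b w Ab Aw P (eps_star b w Ab Aw)"
    using eps_star_least(1)[OF bw pcs A] unique by blast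
  then have opt_S: "?opt Sb Sw"
    unfolding optimally_modified_iff[OF bw pcs A] Sb_def Sw_def
    using S_pcs_mod_feasible[OF bw] S_pcs_shape[OF bw] by blast
  have fixed: "Yb $ b = 1" "Yb $ w = P" "Yw $ w = 1" "Yw $ b = P"
    and prod: "\<And>i. i \<in> others b w \<Longrightarrow> Yb $ i * Yw $ i = P \<and> 0 \<le> Yb $ i \<and> 0 \<le> Yw $ i"
    if "?opt Yb Yw" for Yb Yw
  proof -
    from that have shape: "pcs_shape b w Yb Yw"
      and feas: "mod_feasible b w Ab Aw Yb Yw (eps_star b w Ab Aw)"
      unfolding optimally_modified_iff[OF bw pcs A] by auto
    have "Yb $ w = P"
      using mod_feasible_admissible[OF pcs feas] unique by blast
    then show "Yb $ b = 1" "Yb $ w = P" "Yw $ w = 1" "Yw $ b = P"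
      and "\<And>i. i \<in> others b w \<Longrightarrow> Yb $ i * Yw $ i = P \<and> 0 \<le> Yb $ i \<and> 0 \<le> Yw $ i"
      using shape feas unfolding pcs_shape_def mod_feasible_def by auto
  qed
  have closest: "max \<bar>Sb $ i - Ab $ i\<bar> \<bar>Sw $ i - Aw $ i\<bar> \<le> max \<bar>Yb $ i - Ab $ i\<bar> \<bar>Yw $ i - Aw $ i\<bar>"
    if Y: "?opt Yb Yw" for Yb Yw i
  proof (cases "i \<in> others b w")
    case True
    then show ?thesis
      using shift_le_deviation[of "Yb $ i" "Yw $ i" "Ab $ i" "Aw $ i"] prod[OF Y True]
        pcs_bounds[OF pcs True] by (simp add: S_others)
  next
    case False
    then have "i = b \<or> i = w" unfolding others_def by simp
    then show ?thesis using fixed[OF Y] entries by auto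
  qed
  have best_S: "best_optimally_modified b w Ab Aw Sb Sw"
    unfolding best_optimally_modified_def using opt_S closest by blast
  have "Xb = Sb \<and> Xw = Sw" if best: "best_optimally_modified b w Ab Aw Xb Xw" for Xb Xw
  proof -
    have X: "?opt Xb Xw"
      using best unfolding best_optimally_modified_def by blast
    have "Xb $ i = Sb $ i \<and> Xw $ i = Sw $ i" for i
    proof (cases "i \<in> others b w")
      case True
      have "max \<bar>Xb $ i - Ab $ i\<bar> \<bar>Xw $ i - Aw $ i\<bar> \<le> max \<bar>Sb $ i - Ab $ i\<bar> \<bar>Sw $ i - Aw $ i\<bar>"
        using best opt_S unfolding best_optimally_modified_def by blast
      then show ?thesis
        using nearest_point_unique[of "Xb $ i" "Xw $ i" "Ab $ i" "Aw $ i"] prod[OF X True] pos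
        by (simp add: S_others[OF True])
    next
      case False
      then have "i = b \<or> i = w" unfolding others_def by simp
      then show ?thesis using fixed[OF X] entries by auto
    qed
    then show ?thesis by (simp add: vec_eq_iff)
  qed
  with best_S have "best_optimally_modified b w Ab Aw Xb Xw \<longleftrightarrow> Xb = Sb \<and> Xw = Sw" for Xb Xw
    by blast
  then show ?thesis unfolding S by auto
qed

section \<open>The candidate values of the optimum\<close>

text \<open>
  For \<open>i \<in> D\<^sub>1\<close> the number \<open>\<epsilon>\<^sub>i\<close> is the positive root of \<open>(a + \<epsilon>) * (c + \<epsilon>) = a\<^sub>b\<^sub>w - \<epsilon>\<close>.
\<close>

lemma eps_single_D1:
  assumes pcs: "pcs b w Ab Aw" and i: "i \<in> D1 b w Ab Aw"
  defines "e \<equiv> eps_single w Ab Aw i"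
  shows "(Ab $ i + e) * (Aw $ i + e) = Ab $ w - e"
proof -
  define m where "m = Ab $ i + Aw $ i + 1"
  define q where "q = Ab $ i * Aw $ i - Ab $ w"
  define r where "r = sqrt (m\<^sup>2 - 4 * q)"
  have m: "0 < m" and q: "q < 0"
    using pcs_bounds[OF pcs, of i] i unfolding D1_def m_def q_def by auto
  have r2: "r\<^sup>2 = m\<^sup>2 - 4 * q"
    unfolding r_def using q by (intro real_sqrt_pow2) (smt (verit) zero_le_power2)
  have "m \<le> r"
    unfolding r_def by (rule real_le_rsqrt) (use q in simp)
  then have e: "e = (r - m) / 2"
    unfolding e_def eps_single_def by (simp add: m_def[symmetric] q_def[symmetric] r_def[symmetric])
  have "e * e + m * e + q = (r\<^sup>2 - m\<^sup>2) / 4 + q"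
    unfolding e by (simp add: power2_eq_square field_simps)
  then have "e * e + m * e + q = 0"
    using r2 by simp
  then show ?thesis
    unfolding m_def q_def by (simp add: algebra_simps)
qed

text \<open>
  For \<open>i \<in> D\<^sub>2\<close> the number \<open>\<epsilon>\<^sub>i\<close> is the smaller root of \<open>(a - \<epsilon>) * (c - \<epsilon>) = a\<^sub>b\<^sub>w + \<epsilon>\<close>.  The difference
  of the two sides is negative at \<open>a\<close> and at \<open>c\<close>, which therefore lie between the two roots.
\<close>

lemma eps_single_D2:
  assumes pcs: "pcs b w Ab Aw" and i: "i \<in> D2 b w Ab Aw"
  defines "e \<equiv> eps_single w Ab Aw i"
  shows "(Ab $ i - e) * (Aw $ i - e) = Ab $ w + e" and "e \<le> Ab $ i" and "e \<le> Aw $ i"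
proof -
  define m where "m = Ab $ i + Aw $ i + 1"
  define q where "q = Ab $ i * Aw $ i - Ab $ w"
  define r where "r = sqrt (m\<^sup>2 - 4 * q)"
  have b: "1 \<le> Ab $ i" "1 \<le> Aw $ i" "1 \<le> Ab $ w"
    using pcs_bounds[OF pcs, of i] i unfolding D2_def by auto
  have q: "0 < q"
    using i unfolding D2_def q_def by auto
  have disc: "(Ab $ i - Aw $ i)\<^sup>2 + 1 \<le> m\<^sup>2 - 4 * q"
    using b unfolding m_def q_def by (simp add: power2_eq_square algebra_simps)
  have r2: "r\<^sup>2 = m\<^sup>2 - 4 * q"
    unfolding r_def using disc by (intro real_sqrt_pow2) (smt (verit) zero_le_power2)
  have "r \<le> m"
    unfolding r_def by (rule real_le_lsqrt) (use q b m_def in auto)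
  then have e: "e = (m - r) / 2"
    unfolding e_def eps_single_def by (simp add: m_def[symmetric] q_def[symmetric] r_def[symmetric])
  have "e * e - m * e + q = (r\<^sup>2 - m\<^sup>2) / 4 + q"
    unfolding e by (simp add: power2_eq_square field_simps)
  then have "e * e - m * e + q = 0"
    using r2 by simp
  then show "(Ab $ i - e) * (Aw $ i - e) = Ab $ w + e"
    unfolding m_def q_def by (simp add: algebra_simps)
  \<comment> \<open>A number lies above the smaller root as soon as its distance to the midpoint of the roots is
      at most \<open>r / 2\<close>.\<close>
  have "(Aw $ i - Ab $ i + 1)\<^sup>2 \<le> m\<^sup>2 - 4 * q" "(Ab $ i - Aw $ i + 1)\<^sup>2 \<le> m\<^sup>2 - 4 * q"
    unfolding m_def q_def using b by (simp_all add: power2_eq_square algebra_simps)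
  then have "Aw $ i - Ab $ i + 1 \<le> r" "Ab $ i - Aw $ i + 1 \<le> r"
    unfolding r_def by (simp_all add: real_le_rsqrt)
  then show "e \<le> Ab $ i" "e \<le> Aw $ i"
    unfolding e m_def by simp_all
qed

text \<open>
  The terms \<open>\<epsilon>\<^sup>2\<close> cancel in \<open>(a\<^sub>i + \<epsilon>) * (c\<^sub>i + \<epsilon>) = (a\<^sub>j - \<epsilon>) * (c\<^sub>j - \<epsilon>)\<close>; what remains is linear in
  \<open>\<epsilon>\<close> and has the solution \<open>\<epsilon>\<^sub>i\<^sub>,\<^sub>j\<close>.  The smaller product is the one that is increased.
\<close>

lemma eps_pair_root:
  assumes pos: "0 < Ab $ i" "0 < Aw $ i" "0 < Ab $ j" "0 < Aw $ j"
    and le: "Ab $ i * Aw $ i \<le> Ab $ j * Aw $ j"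
  defines "e \<equiv> eps_pair Ab Aw i j"
  shows "(Ab $ i + e) * (Aw $ i + e) = (Ab $ j - e) * (Aw $ j - e)"
    and "0 \<le> e" and "e \<le> Ab $ j" and "e \<le> Aw $ j"
proof -
  define s where "s = Ab $ i + Aw $ i + Ab $ j + Aw $ j"
  have s: "0 < s"
    unfolding s_def using pos by simp
  have e: "e = (Ab $ j * Aw $ j - Ab $ i * Aw $ i) / s"
    unfolding e_def eps_pair_def s_def[symmetric] using s le by (simp add: abs_divide)
  then have es: "e * s = Ab $ j * Aw $ j - Ab $ i * Aw $ i"
    using s by simp
  then show "(Ab $ i + e) * (Aw $ i + e) = (Ab $ j - e) * (Aw $ j - e)"
    unfolding s_def by (simp add: algebra_simps)
  show "0 \<le> e"
    unfolding e using s le by simp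
  have "0 < Ab $ i * Aw $ i" "0 < Ab $ j * (Ab $ i + Aw $ i + Ab $ j)"
    "0 < Aw $ j * (Ab $ i + Aw $ i + Aw $ j)"
    using pos by simp_all
  then have "e * s \<le> Ab $ j * s" "e * s \<le> Aw $ j * s"
    unfolding es unfolding s_def by (simp_all add: algebra_simps)
  then show "e \<le> Ab $ j" "e \<le> Aw $ j"
    using s by simp_all
qed

theorem theorem3:
  fixes b w :: "'n::finite" and Ab Aw :: "real ^ 'n"
  assumes "CARD('n) \<ge> 3" and "b \<noteq> w" and "pcs b w Ab Aw"
  shows
    "(\<forall>i0 \<in> D1 b w Ab Aw. eps_star b w Ab Aw = eps_single w Ab Aw i0 \<longrightarrow>
        {(Xb, Xw). best_optimally_modified b w Ab Aw Xb Xw}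
          = {S_pcs b w Ab Aw (Ab $ w - eps_single w Ab Aw i0)}) \<and>
     (\<forall>j0 \<in> D2 b w Ab Aw. eps_star b w Ab Aw = eps_single w Ab Aw j0 \<longrightarrow>
        {(Xb, Xw). best_optimally_modified b w Ab Aw Xb Xw}
          = {S_pcs b w Ab Aw (Ab $ w + eps_single w Ab Aw j0)}) \<and>
     (\<forall>i0 \<in> others b w. \<forall>j0 \<in> others b w.
        Ab $ i0 * Aw $ i0 \<le> Ab $ j0 * Aw $ j0 \<longrightarrow>
        eps_star b w Ab Aw = eps_pair Ab Aw i0 j0 \<longrightarrow>
        {(Xb, Xw). best_optimally_modified b w Ab Aw Xb Xw}
          = {S_pcs b w Ab Aw
               ((Ab $ i0 + eps_pair Ab Aw i0 j0) * (Aw $ i0 + eps_pair Ab Aw i0 j0))})"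
proof (intro conjI ballI impI)
  note pcs = assms(3)
  note best = best_singleton[OF assms(2) pcs]
  fix i assume i: "i \<in> D1 b w Ab Aw" and star: "eps_star b w Ab Aw = eps_single w Ab Aw i"
  define e where "e = eps_single w Ab Aw i"
  have io: "i \<in> others b w" using i unfolding D1_def by simp
  note bounds = pcs_bounds[OF pcs io]
  have eq: "(Ab $ i + e) * (Aw $ i + e) = Ab $ w - e"
    unfolding e_def by (rule eps_single_D1[OF pcs i])
  have "0 \<le> e" unfolding e_def eps_single_def by simp
  with bounds have "0 < (Ab $ i + e) * (Aw $ i + e)" by (intro mult_pos_pos) auto
  moreover have "Q = Ab $ w - e" if "admissible b w Ab Aw Q e" for Q
    using that product_le_if_shift_le[of Q "Ab $ i" "Aw $ i" e] io bounds eq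
    unfolding admissible_def by fastforce
  ultimately show "{(Xb, Xw). best_optimally_modified b w Ab Aw Xb Xw}
      = {S_pcs b w Ab Aw (Ab $ w - eps_single w Ab Aw i)}"
    using best[of "Ab $ w - e"] star eq bounds unfolding e_def by simp
next
  note pcs = assms(3)
  note best = best_singleton[OF assms(2) pcs]
  fix j assume j: "j \<in> D2 b w Ab Aw" and star: "eps_star b w Ab Aw = eps_single w Ab Aw j"
  define e where "e = eps_single w Ab Aw j"
  have jo: "j \<in> others b w" using j unfolding D2_def by simp
  note bounds = pcs_bounds[OF pcs jo]
  have eq: "(Ab $ j - e) * (Aw $ j - e) = Ab $ w + e" and le: "e \<le> Ab $ j" "e \<le> Aw $ j"
    unfolding e_def by (rule eps_single_D2[OF pcs j])+
  have "0 \<le> e" unfolding e_def eps_single_def by simp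
  with bounds have "0 < Ab $ w + e" by simp
  moreover have "Q = Ab $ w + e" if "admissible b w Ab Aw Q e" for Q
    using that product_ge_if_shift_le[of Q "Ab $ j" "Aw $ j" e] jo le eq
    unfolding admissible_def by fastforce
  ultimately show "{(Xb, Xw). best_optimally_modified b w Ab Aw Xb Xw}
      = {S_pcs b w Ab Aw (Ab $ w + eps_single w Ab Aw j)}"
    using best[of "Ab $ w + e"] star bounds unfolding e_def by simp
next
  note pcs = assms(3)
  note best = best_singleton[OF assms(2) pcs]
  fix i j assume io: "i \<in> others b w" and jo: "j \<in> others b w"
    and le: "Ab $ i * Aw $ i \<le> Ab $ j * Aw $ j"
    and star: "eps_star b w Ab Aw = eps_pair Ab Aw i j"
  define e where "e = eps_pair Ab Aw i j"
  note bi = pcs_bounds[OF pcs io] and bj = pcs_bounds[OF pcs jo]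
  have eq: "(Ab $ i + e) * (Aw $ i + e) = (Ab $ j - e) * (Aw $ j - e)"
    and e: "0 \<le> e" "e \<le> Ab $ j" "e \<le> Aw $ j"
    unfolding e_def by (rule eps_pair_root; use bi bj le in linarith)+
  have "0 < (Ab $ i + e) * (Aw $ i + e)"
    using bi e by (intro mult_pos_pos) auto
  moreover have "Q = (Ab $ i + e) * (Aw $ i + e)" if "admissible b w Ab Aw Q e" for Q
  proof (rule order_antisym)
    show "Q \<le> (Ab $ i + e) * (Aw $ i + e)"
      using that io bi by (intro product_le_if_shift_le) (auto simp: admissible_def)
    show "(Ab $ i + e) * (Aw $ i + e) \<le> Q"
      unfolding eq using that jo e by (intro product_ge_if_shift_le) (auto simp: admissible_def)
  qed
  ultimately show "{(Xb, Xw). best_optimally_modified b w Ab Aw Xb Xw}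
      = {S_pcs b w Ab Aw ((Ab $ i + eps_pair Ab Aw i j) * (Aw $ i + eps_pair Ab Aw i j))}"
    using best[of "(Ab $ i + e) * (Aw $ i + e)"] star bi unfolding e_def by simp
qed

end
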